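(* Let $S,F,P,W$ be smooth functions of two variables with $S\neq0$, $F>0$, $P>0$. If the spacetime $$ds^2=\frac1{S^2(t,x)}\Big[-dt^2+dx^2+F(t,x)\Big(P^{-1}(t,x)\,dy^2+P(t,x)\big(dz+W(t,x)\,dy\big)^2\Big)\Big]$$ satisfies the equations $$(S_{00}+S_{22})(S_{11}-S_{22})-S_{01}^2=0,\qquad S_{22}-S_{33}=0,\qquad S_{23}=0,$$ then the new metric $$ds^2=\frac1{S^2(x,t)}\Big[-dt^2+dx^2+F(x,t)\Big(P^{-1}(x,t)\,dy^2+P(x,t)\big(dz+W(x,t)\,dy\big)^2\Big)\Big],$$ obtained by interchanging $x$ and $t$ in all metric functions, also satisfies this set of differential equations.
   Context: For each of the two metrics, $S_{\alpha\beta}$ (with two indices) denotes the components of the Einstein tensor of that metric in its orthonormal coframe with timelike $\theta^0$: $$\theta^0=\frac1S dt,\quad \theta^1=\frac1S dx,\quad \theta^2=\frac1S\sqrt{\frac FP}\,dy,\quad \theta^3=\frac1S\sqrt{FP}\,(dz+W\,dy),$$ where $S,F,P,W$ are evaluated at $(t,x)$ for the first metric and at $(x,t)$ for the second. The first metric is considered on $\{(t,x)\in U\}$ for an open set $U\subset\mathbb R^2$ (the common domain of the functions), and the second on $\{(t,x):(x,t)\in U\}$, with $(y,z)\in\mathbb R^2$. *)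

theory Defs
  imports "HOL-Analysis.Analysis"
begin

section \<open>Smooth functions\<close>

primrec higher_differentiable_on :: "'a::euclidean_space set \<Rightarrow> ('a \<Rightarrow> real) \<Rightarrow> nat \<Rightarrow> bool"
where
  "higher_differentiable_on U f 0 \<longleftrightarrow> continuous_on U f"
| "higher_differentiable_on U f (Suc k) \<longleftrightarrow>
     (\<forall>u\<in>U. f differentiable (at u)) \<and>
     (\<forall>v. higher_differentiable_on U (\<lambda>u. frechet_derivative f (at u) v) k)"

text \<open>Intended for open \<open>U\<close> only.\<close>

definition smooth_on :: "'a::euclidean_space set \<Rightarrow> ('a \<Rightarrow> real) \<Rightarrow> bool" where
  "smooth_on U f \<longleftrightarrow> (\<forall>k. higher_differentiable_on U f k)"


section \<open>Curvature of a metric on a coordinate domain in four dimensions\<close>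

text \<open>
  The numeral type \<open>4\<close> has exactly the elements \<open>0, 1, 2, 3\<close> (and \<open>4 = 0\<close>), so a point of
  \<open>real ^ 4\<close> is \<open>(t, x, y, z) = (p $ 0, p $ 1, p $ 2, p $ 3)\<close>. A metric is given by its
  coordinate components as a function of the point. All functions are total, but the quantities
  below at \<open>p\<close> depend only on the metric near \<open>p\<close>.
\<close>

type_synonym tensor2 = "real ^ 4 \<Rightarrow> real ^ 4 ^ 4"

definition pdiff :: "4 \<Rightarrow> (real ^ 4 \<Rightarrow> real) \<Rightarrow> real ^ 4 \<Rightarrow> real" where
  "pdiff a f p = frechet_derivative f (at p) (axis a 1)"

text \<open>\<open>christoffel g a b c\<close> is \<open>\<Gamma>\<close> with upper index \<open>a\<close> and lower indices \<open>b, c\<close>.\<close>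

definition christoffel :: "tensor2 \<Rightarrow> 4 \<Rightarrow> 4 \<Rightarrow> 4 \<Rightarrow> real ^ 4 \<Rightarrow> real" where
  "christoffel g a b c p =
     (\<Sum>d\<in>UNIV. matrix_inv (g p) $ a $ d *
        (pdiff b (\<lambda>q. g q $ d $ c) p + pdiff c (\<lambda>q. g q $ d $ b) p
          - pdiff d (\<lambda>q. g q $ b $ c) p)) / 2"

text \<open>
  \<open>riemann g a b c d\<close> is the \<open>a\<close>-component of \<open>R(\<partial>\<^sub>c, \<partial>\<^sub>d) \<partial>\<^sub>b\<close>, where
  \<open>R(X, Y) = [\<nabla>\<^sub>X, \<nabla>\<^sub>Y] - \<nabla>\<^bsub>[X, Y]\<^esub>\<close>.
\<close>

definition riemann :: "tensor2 \<Rightarrow> 4 \<Rightarrow> 4 \<Rightarrow> 4 \<Rightarrow> 4 \<Rightarrow> real ^ 4 \<Rightarrow> real" where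
  "riemann g a b c d p =
     pdiff c (christoffel g a d b) p - pdiff d (christoffel g a c b) p
     + (\<Sum>e\<in>UNIV. christoffel g a c e p * christoffel g e d b p
                 - christoffel g a d e p * christoffel g e c b p)"

definition ricci :: "tensor2 \<Rightarrow> tensor2" where
  "ricci g p = (\<chi> b d. \<Sum>a\<in>UNIV. riemann g a b a d p)"

definition scalar_curvature :: "tensor2 \<Rightarrow> real ^ 4 \<Rightarrow> real" where
  "scalar_curvature g p = (\<Sum>a\<in>UNIV. \<Sum>b\<in>UNIV. matrix_inv (g p) $ a $ b * ricci g p $ a $ b)"

definition einstein :: "tensor2 \<Rightarrow> tensor2" where
  "einstein g p = ricci g p - (scalar_curvature g p / 2) *\<^sub>R g p"

text \<open>
  A coframe is a matrix field whose row \<open>\<alpha>\<close> holds the coordinate components of the one-form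
  \<open>\<theta>\<close> with index \<open>\<alpha>\<close>. Column \<open>\<alpha>\<close> of the inverse matrix then holds the components of the
  vector \<open>e\<close> with index \<open>\<alpha>\<close> of the dual frame, and the component of \<open>T\<close> is \<open>T (e \<alpha>) (e \<beta>)\<close>.
\<close>

definition frame_component :: "tensor2 \<Rightarrow> tensor2 \<Rightarrow> 4 \<Rightarrow> 4 \<Rightarrow> real ^ 4 \<Rightarrow> real" where
  "frame_component \<theta> T \<alpha> \<beta> p =
     (\<Sum>a\<in>UNIV. \<Sum>b\<in>UNIV. T p $ a $ b * matrix_inv (\<theta> p) $ a $ \<alpha> * matrix_inv (\<theta> p) $ b $ \<beta>)"


section \<open>The line element and its orthonormal coframe\<close>

definition dcoord :: "4 \<Rightarrow> real ^ 4" where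
  "dcoord a = axis a 1"

abbreviation "dt \<equiv> dcoord 0"
abbreviation "dx \<equiv> dcoord 1"
abbreviation "dy \<equiv> dcoord 2"
abbreviation "dz \<equiv> dcoord 3"

definition covec_square :: "real ^ 4 \<Rightarrow> real ^ 4 ^ 4" where
  "covec_square \<omega> = (\<chi> a b. \<omega> $ a * \<omega> $ b)"

definition line_element ::
  "(real \<times> real \<Rightarrow> real) \<Rightarrow> (real \<times> real \<Rightarrow> real) \<Rightarrow> (real \<times> real \<Rightarrow> real) \<Rightarrow> (real \<times> real \<Rightarrow> real)
    \<Rightarrow> tensor2" where
  "line_element S F P W p =
     (let u = (p $ 0, p $ 1) in
      (1 / (S u)\<^sup>2) *\<^sub>R
        (- covec_square dt + covec_square dx
         + F u *\<^sub>R ((1 / P u) *\<^sub>R covec_square dy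
                   + P u *\<^sub>R covec_square (dz + W u *\<^sub>R dy))))"

definition coframe ::
  "(real \<times> real \<Rightarrow> real) \<Rightarrow> (real \<times> real \<Rightarrow> real) \<Rightarrow> (real \<times> real \<Rightarrow> real) \<Rightarrow> (real \<times> real \<Rightarrow> real)
    \<Rightarrow> tensor2" where
  "coframe S F P W p =
     (let u = (p $ 0, p $ 1) in
      (\<chi> \<alpha>. if \<alpha> = 0 then (1 / S u) *\<^sub>R dt
           else if \<alpha> = 1 then (1 / S u) *\<^sub>R dx
           else if \<alpha> = 2 then (1 / S u * sqrt (F u / P u)) *\<^sub>R dy
           else (1 / S u * sqrt (F u * P u)) *\<^sub>R (dz + W u *\<^sub>R dy)))"

lemma line_element_coframe:
  fixes S F P W :: "real \<times> real \<Rightarrow> real"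
  assumes "S (p $ 0, p $ 1) \<noteq> 0" "F (p $ 0, p $ 1) > 0" "P (p $ 0, p $ 1) > 0"
  defines "\<theta> \<equiv> coframe S F P W p"
  shows "line_element S F P W p =
    - covec_square (\<theta> $ 0) + covec_square (\<theta> $ 1) + covec_square (\<theta> $ 2) + covec_square (\<theta> $ 3)"
proof -
  have *: "covec_square (c *\<^sub>R \<omega>) = c\<^sup>2 *\<^sub>R covec_square \<omega>" for c \<omega>
    by (simp add: covec_square_def vec_eq_iff power2_eq_square)
  show ?thesis
    using assms(1-3)
    apply (simp add: \<theta>_def line_element_def coframe_def Let_def * power_mult_distrib power_divide)
    apply (simp only: scaleR_add_right[of "1 / _"] scaleR_diff_right scaleR_scaleR)
    apply (simp add: scaleR_add_right mult.commute)
    done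
qed

definition einstein_frame ::
  "(real \<times> real \<Rightarrow> real) \<Rightarrow> (real \<times> real \<Rightarrow> real) \<Rightarrow> (real \<times> real \<Rightarrow> real) \<Rightarrow> (real \<times> real \<Rightarrow> real)
    \<Rightarrow> 4 \<Rightarrow> 4 \<Rightarrow> real ^ 4 \<Rightarrow> real" where
  "einstein_frame S F P W = frame_component (coframe S F P W) (einstein (line_element S F P W))"

definition field_equations_at ::
  "(real \<times> real \<Rightarrow> real) \<Rightarrow> (real \<times> real \<Rightarrow> real) \<Rightarrow> (real \<times> real \<Rightarrow> real) \<Rightarrow> (real \<times> real \<Rightarrow> real)
    \<Rightarrow> real ^ 4 \<Rightarrow> bool" where
  "field_equations_at S F P W p \<longleftrightarrow>
     (let G = (\<lambda>\<alpha> \<beta>. einstein_frame S F P W \<alpha> \<beta> p) in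
      (G 0 0 + G 2 2) * (G 1 1 - G 2 2) - (G 0 1)\<^sup>2 = 0 \<and>
      G 2 2 - G 3 3 = 0 \<and>
      G 2 3 = 0)"

end

(*
  Exchange the coordinates t and x in the new metric. The result is the old metric with the sign of
  its (t, x)-block reversed, that is, minus the old metric after the formal substitution
  (y, z) -> (i y, i z). No tensor component has an odd number of indices y, z, so this substitution
  only contributes real signs: the Christoffel symbols, the Ricci tensor and the scalar curvature
  of the two metrics agree up to explicit signs, and no component needs to be computed. In the
  orthonormal frames S_00 and S_11 are exchanged, S_01 becomes S_10, and S_22, S_33, S_23 change
  sign, which maps the system to itself once S_01 = S_10 is known. That symmetry of the Ricci tensor
  comes down to symmetry of d (tr (g^-1 dg)), hence to Young's theorem on mixed derivatives.
*)
theory Submission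
  imports Defs
begin

section \<open>Exchange of t and x on indices and points\<close>

definition swap_index :: "4 \<Rightarrow> 4" where
  "swap_index a = (if a = 0 then 1 else if a = 1 then 0 else a)"

definition swap_tx :: "real ^ 4 \<Rightarrow> real ^ 4" where
  "swap_tx p = (\<chi> a. p $ swap_index a)"

text \<open>The sign that the exchange leaves on each diagonal block of the metric. Comparing two
  values also serves as the test that two indices lie in the same block, {t, x} or {y, z}.\<close>

definition block_sign :: "4 \<Rightarrow> real" where
  "block_sign a = (if a = 0 \<or> a = 1 then -1 else 1)"

lemma index4_cases: "a = 0 \<or> a = 1 \<or> a = 2 \<or> a = (3::4)"
  using exhaust_4[of a] by auto

lemma sum_index4: "(\<Sum>a\<in>(UNIV::4 set). f a) = f 0 + f 1 + f 2 + f 3"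
  for f :: "4 \<Rightarrow> real"
proof -
  have "(4::4) = 0" by simp
  from sum_4[of f, unfolded this] show ?thesis by simp
qed

lemma swap_index_swap_index [simp]: "swap_index (swap_index a) = a"
  by (auto simp: swap_index_def)

lemma swap_index_eq_iff [simp]: "swap_index a = swap_index b \<longleftrightarrow> a = b"
  by (metis swap_index_swap_index)

lemma block_sign_swap_index [simp]: "block_sign (swap_index a) = block_sign a"
  by (auto simp: swap_index_def block_sign_def)

lemma block_sign_mult_self [simp]: "block_sign a * block_sign a = 1"
  by (simp add: block_sign_def)

lemma block_sign_disj: "block_sign a = -1 \<or> block_sign a = 1"
  by (simp add: block_sign_def)

lemma swap_tx_swap_tx [simp]: "swap_tx (swap_tx p) = p"
  by (simp add: swap_tx_def vec_eq_iff)

lemma swap_tx_nth [simp]: "swap_tx p $ a = p $ swap_index a"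
  by (simp add: swap_tx_def)

lemma sum_swap_index: "(\<Sum>a\<in>UNIV. f (swap_index a)) = (\<Sum>a\<in>UNIV. f a)"
  by (rule sum.reindex_bij_witness[of _ swap_index swap_index]) auto

lemma bounded_linear_swap_tx: "bounded_linear swap_tx"
  unfolding linear_conv_bounded_linear[symmetric]
  by (rule linearI) (auto simp: vec_eq_iff)

lemma swap_tx_axis: "swap_tx (axis a 1) = axis (swap_index a) 1"
  by (auto simp: vec_eq_iff axis_def)

lemma open_swap_tx_vimage: "open V \<Longrightarrow> open (swap_tx -` V)"
  by (intro open_vimage linear_continuous_on bounded_linear_swap_tx)

section \<open>Partial derivatives: locality and the chain rule for the exchange\<close>

lemma pdiff_eqI: "(f has_derivative f') (at p) \<Longrightarrow> pdiff a f p = f' (axis a 1)"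
  unfolding pdiff_def using frechet_derivative_at by metis

text \<open>Identities for the inverse metric and the Christoffel symbols are available only on an
  open set; this is how they are differentiated there.\<close>

lemma pdiff_transform:
  assumes "open V" "p \<in> V" "\<And>q. q \<in> V \<Longrightarrow> f q = h q" "h differentiable (at p)"
  shows "pdiff a f p = pdiff a h p"
proof -
  have "(h has_derivative frechet_derivative h (at p)) (at p)"
    using assms(4) by (simp add: frechet_derivative_works)
  then have "(f has_derivative frechet_derivative h (at p)) (at p)"
    by (rule has_derivative_transform_within_open[OF _ assms(1,2)]) (simp add: assms(3))
  then show ?thesis by (simp add: pdiff_eqI) (simp add: pdiff_def)
qed

text \<open>Chain rule for a linear map that permutes the coordinate vectors. The constant
  \<open>c\<close> is there to receive the block signs.\<close>

lemma pdiff_swap_tx: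
  assumes "f differentiable (at (swap_tx p))"
  shows "pdiff a (\<lambda>q. c * f (swap_tx q)) p = c * pdiff (swap_index a) f (swap_tx p)"
proof -
  have "(f has_derivative frechet_derivative f (at (swap_tx p))) (at (swap_tx p))"
    using assms by (simp add: frechet_derivative_works)
  from diff_chain_at[OF bounded_linear_imp_has_derivative[OF bounded_linear_swap_tx] this]
  have "((\<lambda>q. c * f (swap_tx q)) has_derivative
      (\<lambda>v. c * frechet_derivative f (at (swap_tx p)) (swap_tx v))) (at p)"
    by (intro has_derivative_mult_right) (simp add: o_def)
  then show ?thesis
    by (simp add: pdiff_eqI swap_tx_axis) (simp add: pdiff_def)
qed

section \<open>Functions that depend on t and x alone\<close>

text \<open>
  Functions of \<open>t\<close> and \<open>x\<close> alone, expressed infinitesimally: the coefficient functions are only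
  controlled on \<open>U\<close>, so the Christoffel symbols need not factor globally through \<open>(t, x)\<close>.
\<close>

definition cylindrical :: "(real ^ 4) set \<Rightarrow> (real ^ 4 \<Rightarrow> real) \<Rightarrow> bool" where
  "cylindrical V f \<longleftrightarrow>
     (\<forall>p\<in>V. f differentiable (at p) \<and> (\<forall>a. block_sign a = 1 \<longrightarrow> pdiff a f p = 0))"

text \<open>The regularity asked of the metric: Christoffel symbols, built from its first
  derivatives, are then \<open>cylindrical\<close> themselves, and Young's theorem applies to its
  second derivatives.\<close>

definition cylindrical2 :: "(real ^ 4) set \<Rightarrow> (real ^ 4 \<Rightarrow> real) \<Rightarrow> bool" where
  "cylindrical2 V f \<longleftrightarrow> cylindrical V f \<and> (\<forall>a. cylindrical V (pdiff a f))"

lemma pdiff_const [simp]: "pdiff a (\<lambda>_. c) p = 0"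
  using pdiff_eqI[OF has_derivative_const] by simp

lemma pdiff_add:
  assumes "f differentiable (at p)" "h differentiable (at p)"
  shows "pdiff a (\<lambda>q. f q + h q) p = pdiff a f p + pdiff a h p"
  using pdiff_eqI[OF has_derivative_add[OF assms[unfolded frechet_derivative_works]]]
  by (simp add: pdiff_def)

lemma pdiff_mult:
  assumes "f differentiable (at p)" "h differentiable (at p)"
  shows "pdiff a (\<lambda>q. f q * h q) p = f p * pdiff a h p + pdiff a f p * h p"
  using pdiff_eqI[OF has_derivative_mult[OF assms[unfolded frechet_derivative_works]]]
  by (simp add: pdiff_def)

lemma pdiff_inverse:
  assumes "f differentiable (at p)" "f p \<noteq> 0"
  shows "pdiff a (\<lambda>q. inverse (f q)) p = - (inverse (f p) * pdiff a f p * inverse (f p))"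
  using pdiff_eqI[OF Deriv.has_derivative_inverse[OF assms(2) assms(1)[unfolded frechet_derivative_works]]]
  by (simp add: pdiff_def)

lemma cylindrical_const: "cylindrical V (\<lambda>_. c)"
  by (simp add: cylindrical_def)

lemma cylindrical_add:
  "cylindrical V f \<Longrightarrow> cylindrical V h \<Longrightarrow> cylindrical V (\<lambda>p. f p + h p)"
  by (auto simp: cylindrical_def pdiff_add)

lemma cylindrical_mult:
  "cylindrical V f \<Longrightarrow> cylindrical V h \<Longrightarrow> cylindrical V (\<lambda>p. f p * h p)"
  by (auto simp: cylindrical_def pdiff_mult)

lemma cylindrical_inverse:
  "cylindrical V f \<Longrightarrow> (\<And>p. p \<in> V \<Longrightarrow> f p \<noteq> 0) \<Longrightarrow> cylindrical V (\<lambda>p. inverse (f p))"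
  by (auto simp: cylindrical_def pdiff_inverse)

lemma cylindrical_uminus: "cylindrical V f \<Longrightarrow> cylindrical V (\<lambda>p. - f p)"
  using cylindrical_mult[OF cylindrical_const[of V "-1"], of f] by simp

lemma cylindrical_diff:
  "cylindrical V f \<Longrightarrow> cylindrical V h \<Longrightarrow> cylindrical V (\<lambda>p. f p - h p)"
  using cylindrical_add[OF _ cylindrical_uminus, of V f h] by simp

lemma cylindrical_sum:
  "(\<And>i. i \<in> I \<Longrightarrow> cylindrical V (f i)) \<Longrightarrow> cylindrical V (\<lambda>p. \<Sum>i\<in>I. f i p)"
  by (induction I rule: infinite_finite_induct) (auto intro: cylindrical_const cylindrical_add)

text \<open>Differentiability and partial derivatives are local. This serves functions known in
  closed form only on \<open>V\<close>, such as the derivative of a product or the inverse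
  metric.\<close>

lemma cylindrical_cong:
  assumes "open V" "cylindrical V h" "\<And>p. p \<in> V \<Longrightarrow> f p = h p"
  shows "cylindrical V f"
proof -
  have "f differentiable (at p)" if "p \<in> V" for p
    using assms that unfolding cylindrical_def differentiable_def
    by (metis has_derivative_transform_within_open)
  moreover have "pdiff a f p = pdiff a h p" if "p \<in> V" for a p
    using assms that by (intro pdiff_transform[OF assms(1) that assms(3)])
      (auto simp: cylindrical_def)
  ultimately show ?thesis using assms(2) by (auto simp: cylindrical_def)
qed

lemma cylindrical2_const: "cylindrical2 V (\<lambda>_. c)"
proof -
  have "pdiff a (\<lambda>_. c) = (\<lambda>_. 0)" for a by auto
  then show ?thesis by (simp add: cylindrical2_def cylindrical_const)
qed

lemma cylindrical2_add:
  assumes "open V" "cylindrical2 V f" "cylindrical2 V h"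
  shows "cylindrical2 V (\<lambda>p. f p + h p)"
proof -
  have "cylindrical V (pdiff a (\<lambda>p. f p + h p))" for a
    by (rule cylindrical_cong[OF assms(1), where h = "\<lambda>p. pdiff a f p + pdiff a h p"])
      (use assms(2,3) in \<open>auto intro!: cylindrical_add pdiff_add simp: cylindrical2_def cylindrical_def[of V f] cylindrical_def[of V h]\<close>)
  then show ?thesis using assms by (simp add: cylindrical2_def cylindrical_add)
qed

lemma cylindrical2_mult:
  assumes "open V" "cylindrical2 V f" "cylindrical2 V h"
  shows "cylindrical2 V (\<lambda>p. f p * h p)"
proof -
  have "cylindrical V (pdiff a (\<lambda>p. f p * h p))" for a
  proof (rule cylindrical_cong[OF assms(1)])
    show "cylindrical V (\<lambda>p. f p * pdiff a h p + pdiff a f p * h p)"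
      using assms(2,3) by (auto intro!: cylindrical_add cylindrical_mult simp: cylindrical2_def)
  qed (use assms(2,3) in \<open>auto intro!: pdiff_mult simp: cylindrical2_def cylindrical_def\<close>)
  then show ?thesis using assms by (simp add: cylindrical2_def cylindrical_mult)
qed

lemma cylindrical2_inverse:
  assumes "open V" "cylindrical2 V f" "\<And>p. p \<in> V \<Longrightarrow> f p \<noteq> 0"
  shows "cylindrical2 V (\<lambda>p. inverse (f p))"
proof -
  have "cylindrical V (pdiff a (\<lambda>p. inverse (f p)))" for a
  proof (rule cylindrical_cong[OF assms(1)])
    show "cylindrical V (\<lambda>p. - (inverse (f p) * pdiff a f p * inverse (f p)))"
      using assms(2,3)
      by (intro cylindrical_uminus cylindrical_mult cylindrical_inverse) (auto simp: cylindrical2_def)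
  qed (use assms(2,3) in \<open>auto intro!: pdiff_inverse simp: cylindrical2_def cylindrical_def\<close>)
  then show ?thesis using assms by (simp add: cylindrical2_def cylindrical_inverse)
qed

section \<open>Lifting functions of two variables to four\<close>

lemma pdiff_lift:
  assumes "h differentiable (at (p $ 0, p $ 1))"
  shows "(\<lambda>p::real^4. h (p $ 0, p $ 1)) differentiable (at p)"
    and "pdiff a (\<lambda>p. h (p $ 0, p $ 1)) p =
      frechet_derivative h (at (p $ 0, p $ 1)) (axis a 1 $ 0, axis a 1 $ 1)"
proof -
  have "bounded_linear (\<lambda>p::real^4. (p $ 0, p $ 1))"
    by (intro bounded_linear_Pair bounded_linear_vec_nth)
  from diff_chain_at[OF bounded_linear_imp_has_derivative[OF this]
      assms[unfolded frechet_derivative_works]]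
  have *: "((\<lambda>p::real^4. h (p $ 0, p $ 1)) has_derivative
     (\<lambda>v. frechet_derivative h (at (p $ 0, p $ 1)) (v $ 0, v $ 1))) (at p)"
    by (simp add: o_def)
  show "(\<lambda>p::real^4. h (p $ 0, p $ 1)) differentiable (at p)"
    using * by (auto simp: differentiable_def)
  show "pdiff a (\<lambda>p. h (p $ 0, p $ 1)) p =
      frechet_derivative h (at (p $ 0, p $ 1)) (axis a 1 $ 0, axis a 1 $ 1)"
    using pdiff_eqI[OF *] by simp
qed

text \<open>The coordinate vectors of y and z project to 0 in the (t, x)-plane, and the derivative
  of \<open>h\<close>, being linear, vanishes there.\<close>

lemma cylindrical_lift:
  assumes "\<And>u. u \<in> U \<Longrightarrow> h differentiable (at u)"
  shows "cylindrical {p. (p $ 0, p $ 1) \<in> U} (\<lambda>p. h (p $ 0, p $ 1))"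
proof -
  have "(axis a (1::real) $ 0, axis a (1::real) $ 1) = 0" if "block_sign a = 1" for a
    using that by (auto simp: block_sign_def axis_def zero_prod_def split: if_splits)
  moreover have "linear (frechet_derivative h (at u))" if "u \<in> U" for u
    using assms[OF that] by (rule linear_frechet_derivative)
  ultimately show ?thesis
    unfolding cylindrical_def
    by (auto simp: pdiff_lift assms linear_0)
qed

lemma open_lift: "open U \<Longrightarrow> open {p::real^4. (p $ 0, p $ 1) \<in> U}"
  using open_vimage[of U "\<lambda>p::real^4. (p $ 0, p $ 1)"]
  by (simp add: vimage_def continuous_intros)

text \<open>A partial derivative of the lift is itself the lift of a directional derivative of
  \<open>h\<close>, so the first-order result applies again.\<close>

lemma cylindrical2_lift:
  assumes "open U" "smooth_on U h"
  shows "cylindrical2 {p. (p $ 0, p $ 1) \<in> U} (\<lambda>p. h (p $ 0, p $ 1))"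
proof -
  have "higher_differentiable_on U h (Suc (Suc 0))"
    using assms(2) unfolding smooth_on_def by blast
  then have 1: "h differentiable (at u)"
    and 2: "(\<lambda>u. frechet_derivative h (at u) v) differentiable (at u)" if "u \<in> U" for u v
    using that by (auto simp del: split_paired_All)
  have "cylindrical {p. (p $ 0, p $ 1) \<in> U} (pdiff a (\<lambda>p. h (p $ 0, p $ 1)))" for a
    by (rule cylindrical_cong[OF open_lift[OF assms(1)]
      cylindrical_lift[where h = "\<lambda>u. frechet_derivative h (at u) (axis a 1 $ 0, axis a 1 $ 1)"]])
      (auto simp: 2 pdiff_lift 1)
  then show ?thesis by (simp add: cylindrical2_def cylindrical_lift 1)
qed

section \<open>Young's theorem on mixed derivatives\<close>

text \<open>The mean value theorem in direction \<open>u\<close> turns the second difference into s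
  times an increment of \<open>?h\<close>, the derivative of \<open>f\<close> along
  \<open>u\<close>. Differentiability of \<open>?h\<close> at \<open>p\<close> then evaluates this
  increment as s times \<open>?D v\<close> up to o(s).\<close>

lemma second_difference_quotient_tendsto:
  fixes f :: "'a::real_normed_vector \<Rightarrow> real"
  assumes "open V" "p \<in> V" and f: "\<And>q. q \<in> V \<Longrightarrow> f differentiable (at q)"
    and f2: "(\<lambda>q. frechet_derivative f (at q) u) differentiable (at p)"
  shows "((\<lambda>s. (f (p + s *\<^sub>R u + s *\<^sub>R v) - f (p + s *\<^sub>R u) - f (p + s *\<^sub>R v) + f p) / s\<^sup>2) \<longlongrightarrow>
    frechet_derivative (\<lambda>q. frechet_derivative f (at q) u) (at p) v) (at_right 0)"
    (is "(?\<Delta> \<longlongrightarrow> ?D v) _")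
proof (rule tendstoI)
  fix e :: real assume "e > 0"
  let ?h = "\<lambda>q. frechet_derivative f (at q) u"
  have D: "(?h has_derivative ?D) (at p)"
    using f2 by (simp add: frechet_derivative_works)
  then have lin: "linear ?D" by (rule has_derivative_linear)
  \<comment> \<open>\<open>K\<close> bounds the displacements from \<open>p\<close> per unit of s;
    the summand 1 keeps it positive.\<close>
  define K where "K = norm u + norm v + 1"
  have "K > 0" by (simp add: K_def add_nonneg_pos)
  \<comment> \<open>With this tolerance each displacement of norm at most s K costs e s / 3. Two of
    them occur, which leaves the total strictly below e s.\<close>
  have "e / (3 * K) > 0" using \<open>e > 0\<close> \<open>K > 0\<close> by simp
  then obtain d where "d > 0"
    and d: "\<And>y. norm (y - p) < d \<Longrightarrow> norm (?h y - ?h p - ?D (y - p)) \<le> e / (3 * K) * norm (y - p)"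
    using D[unfolded has_derivative_at_alt] by blast
  from assms(1,2) obtain r where "r > 0" and r: "ball p r \<subseteq> V"
    using openE by metis
  define b where "b = min d r / K"
  have "b > 0" using \<open>d > 0\<close> \<open>r > 0\<close> \<open>K > 0\<close> by (simp add: b_def)
  have "dist (?\<Delta> s) (?D v) < e" if s: "0 < s" "s < b" for s
  proof -
    have sK: "s * K < d" "s * K < r"
      using s(2) \<open>K > 0\<close> by (simp_all add: b_def pos_less_divide_eq)
    have small: "norm (x *\<^sub>R u + c *\<^sub>R v) \<le> s * K"
      if "0 \<le> x" "x \<le> s" "c = 0 \<or> c = s" for x c
    proof -
      have "norm (x *\<^sub>R u + c *\<^sub>R v) \<le> x * norm u + c * norm v"
        using that s norm_triangle_ineq[of "x *\<^sub>R u" "c *\<^sub>R v"] by auto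
      also have "\<dots> \<le> s * norm u + s * norm v"
        using that s by (intro add_mono mult_right_mono) auto
      also have "\<dots> \<le> s * K" using s by (simp add: K_def algebra_simps)
      finally show ?thesis .
    qed
    have der: "((\<lambda>x. f (p + x *\<^sub>R u + c *\<^sub>R v)) has_real_derivative
        ?h (p + x *\<^sub>R u + c *\<^sub>R v)) (at x)" if "0 \<le> x" "x \<le> s" "c = 0 \<or> c = s" for x c
    proof -
      let ?q = "p + x *\<^sub>R u + c *\<^sub>R v"
      have "dist p ?q = norm (x *\<^sub>R u + c *\<^sub>R v)"
        using dist_add_cancel[of p 0 "x *\<^sub>R u + c *\<^sub>R v"] by (simp add: add.assoc)
      then have "?q \<in> V"
        using r small[OF that] sK by auto
      then have df: "(f has_derivative frechet_derivative f (at ?q)) (at ?q)"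
        using f by (simp add: frechet_derivative_works)
      have "((\<lambda>x. p + x *\<^sub>R u + c *\<^sub>R v) has_derivative (\<lambda>y. y *\<^sub>R u)) (at x)"
        by (auto intro!: derivative_eq_intros)
      from diff_chain_at[OF this df]
      have "((\<lambda>x. f (p + x *\<^sub>R u + c *\<^sub>R v)) has_derivative
          (\<lambda>y. frechet_derivative f (at ?q) (y *\<^sub>R u))) (at x)"
        by (simp add: o_def)
      also have "(\<lambda>y. frechet_derivative f (at ?q) (y *\<^sub>R u)) = (*) (?h ?q)"
        using linear_cmul[OF has_derivative_linear[OF df]] by (auto simp: mult.commute)
      finally show ?thesis by (simp add: has_field_derivative_def)
    qed
    have "((\<lambda>x. f (p + x *\<^sub>R u + s *\<^sub>R v) - f (p + x *\<^sub>R u)) has_real_derivative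
        ?h (p + x *\<^sub>R u + s *\<^sub>R v) - ?h (p + x *\<^sub>R u)) (at x)" if "0 \<le> x" "x \<le> s" for x
      using DERIV_diff[OF der[OF that, of s] der[OF that, of 0]] by simp
    from MVT2[OF s(1) this] obtain x where x: "0 < x" "x < s"
      and "f (p + s *\<^sub>R u + s *\<^sub>R v) - f (p + s *\<^sub>R u)
        - (f (p + 0 *\<^sub>R u + s *\<^sub>R v) - f (p + 0 *\<^sub>R u)) =
        (s - 0) * (?h (p + x *\<^sub>R u + s *\<^sub>R v) - ?h (p + x *\<^sub>R u))"
      by blast
    then have eq: "f (p + s *\<^sub>R u + s *\<^sub>R v) - f (p + s *\<^sub>R u) - f (p + s *\<^sub>R v) + f p =
        s * (?h (p + x *\<^sub>R u + s *\<^sub>R v) - ?h (p + x *\<^sub>R u))"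
      by simp
    have est: "\<bar>?h (p + w) - ?h p - ?D w\<bar> \<le> e / 3 * s" if "norm w \<le> s * K" for w
    proof -
      have "\<bar>?h (p + w) - ?h p - ?D w\<bar> \<le> e / (3 * K) * norm w"
        using d[of "p + w"] that sK by simp
      also have "\<dots> \<le> e / (3 * K) * (s * K)"
        using that \<open>e > 0\<close> \<open>K > 0\<close> by (intro mult_left_mono) auto
      also have "\<dots> = e / 3 * s" using \<open>K > 0\<close> by simp
      finally show ?thesis .
    qed
    \<comment> \<open>\<open>?h\<close> is approximated to first order at both ends of the
      increment. The intermediate point x is unknown, but it drops out of the difference of the
      linear parts.\<close>
    have "?D (x *\<^sub>R u + s *\<^sub>R v) - ?D (x *\<^sub>R u) = s * ?D v"
      by (simp add: linear_add[OF lin] linear_cmul[OF lin])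
    moreover have "\<bar>?h (p + (x *\<^sub>R u + s *\<^sub>R v)) - ?h p - ?D (x *\<^sub>R u + s *\<^sub>R v)\<bar> \<le> e / 3 * s"
      using small[of x s] x by (intro est) auto
    moreover have "\<bar>?h (p + x *\<^sub>R u) - ?h p - ?D (x *\<^sub>R u)\<bar> \<le> e / 3 * s"
      using small[of x 0] x by (intro est) auto
    moreover have "e / 3 * s + e / 3 * s < e * s"
      using \<open>e > 0\<close> s by (simp add: field_simps)
    ultimately have "\<bar>?h (p + x *\<^sub>R u + s *\<^sub>R v) - ?h (p + x *\<^sub>R u) - s * ?D v\<bar> < e * s"
      unfolding add.assoc by linarith
    moreover have "?\<Delta> s - ?D v =
        (?h (p + x *\<^sub>R u + s *\<^sub>R v) - ?h (p + x *\<^sub>R u) - s * ?D v) / s"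
      unfolding eq using s by (simp add: power2_eq_square diff_divide_distrib)
    ultimately show ?thesis
      using s by (simp add: dist_real_def abs_divide pos_divide_less_eq)
  qed
  then show "\<forall>\<^sub>F s in at_right 0. dist (?\<Delta> s) (?D v) < e"
    using \<open>b > 0\<close> by (auto simp: eventually_at_right_field)
qed

text \<open>The second difference is symmetric in \<open>u\<close> and \<open>v\<close>.\<close>

lemma young_symmetric:
  fixes f :: "'a::real_normed_vector \<Rightarrow> real"
  assumes "open V" "p \<in> V" "\<And>q. q \<in> V \<Longrightarrow> f differentiable (at q)"
    and "(\<lambda>q. frechet_derivative f (at q) u) differentiable (at p)"
    and "(\<lambda>q. frechet_derivative f (at q) v) differentiable (at p)"
  shows "frechet_derivative (\<lambda>q. frechet_derivative f (at q) u) (at p) v =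
    frechet_derivative (\<lambda>q. frechet_derivative f (at q) v) (at p) u"
proof (rule tendsto_unique[OF trivial_limit_at_right_real])
  show "((\<lambda>s. (f (p + s *\<^sub>R u + s *\<^sub>R v) - f (p + s *\<^sub>R u) - f (p + s *\<^sub>R v) + f p) / s\<^sup>2)
    \<longlongrightarrow> frechet_derivative (\<lambda>q. frechet_derivative f (at q) u) (at p) v) (at_right 0)"
    by (rule second_difference_quotient_tendsto[OF assms(1-4)])
  show "((\<lambda>s. (f (p + s *\<^sub>R u + s *\<^sub>R v) - f (p + s *\<^sub>R u) - f (p + s *\<^sub>R v) + f p) / s\<^sup>2)
    \<longlongrightarrow> frechet_derivative (\<lambda>q. frechet_derivative f (at q) v) (at p) u) (at_right 0)"
    using second_difference_quotient_tendsto[OF assms(1-3,5), of u] by (simp add: algebra_simps)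
qed

lemma pdiff_commute:
  assumes "open V" "p \<in> V" "cylindrical2 V f"
  shows "pdiff a (pdiff b f) p = pdiff b (pdiff a f) p"
proof -
  have "pdiff c f = (\<lambda>q. frechet_derivative f (at q) (axis c 1))" for c
    by (simp add: pdiff_def fun_eq_iff)
  moreover have "pdiff c f differentiable (at p)" for c
    using assms by (auto simp: cylindrical2_def cylindrical_def)
  moreover have "f differentiable (at q)" if "q \<in> V" for q
    using assms(3) that by (auto simp: cylindrical2_def cylindrical_def)
  ultimately show ?thesis
    using young_symmetric[OF assms(1,2), of f "axis b 1" "axis a 1"] by (simp add: pdiff_def)
qed

section \<open>Derivatives of sums and multiples; inverse matrices\<close>

lemma pdiff_sum:
  "finite I \<Longrightarrow> (\<And>i. i \<in> I \<Longrightarrow> f i differentiable (at p)) \<Longrightarrow>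
    pdiff a (\<lambda>q. \<Sum>i\<in>I. f i q) p = (\<Sum>i\<in>I. pdiff a (f i) p)"
  by (induction I rule: finite_induct) (simp_all add: pdiff_add)

lemma pdiff_cmult:
  "f differentiable (at p) \<Longrightarrow> pdiff a (\<lambda>q. c * f q) p = c * pdiff a f p"
  using pdiff_mult[of "\<lambda>_. c" p f a] by simp

text \<open>\<open>matrix_inv\<close> is a choice among two-sided inverses. For square matrices a
  right inverse is two-sided, so a candidate exists, and it is the only one.\<close>

lemma matrix_inv_eqI:
  fixes A B :: "real ^ 'n ^ 'n"
  assumes "A ** B = mat 1"
  shows "matrix_inv A = B"
proof -
  have BA: "B ** A = mat 1" using assms by (simp add: matrix_left_right_inverse)
  have "A ** matrix_inv A = mat 1 \<and> matrix_inv A ** A = mat 1"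
    unfolding matrix_inv_def
    by (rule someI[where P = "\<lambda>X. A ** X = mat 1 \<and> X ** A = mat 1", OF conjI[OF assms BA]])
  then have "B ** (A ** matrix_inv A) = B" by simp
  then show ?thesis by (simp add: matrix_mul_assoc BA)
qed

section \<open>Christoffel symbols of a block metric and symmetry of its Ricci tensor\<close>

text \<open>Collects the properties of the line element from which the curvature argument proceeds.
  Symmetry and block form of \<open>g\<close> are assumed at every point, so they are equations
  between functions and may be used under \<open>pdiff\<close>; the facts on the inverse are
  confined to \<open>V\<close>, where \<open>g\<close> is known to be invertible.\<close>

locale block_metric =
  fixes g :: tensor2 and V :: "(real ^ 4) set"
  assumes open_domain: "open V"
    and cylindrical2_metric: "cylindrical2 V (\<lambda>p. g p $ a $ b)"
    and cylindrical_inv: "cylindrical V (\<lambda>p. matrix_inv (g p) $ a $ b)"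
    and metric_symmetric: "g p $ a $ b = g p $ b $ a"
    and metric_block: "block_sign a \<noteq> block_sign b \<Longrightarrow> g p $ a $ b = 0"
    and inv_block: "p \<in> V \<Longrightarrow> block_sign a \<noteq> block_sign b \<Longrightarrow> matrix_inv (g p) $ a $ b = 0"
    and metric_inverse: "p \<in> V \<Longrightarrow> g p ** matrix_inv (g p) = mat 1"
begin

lemma pdiff_metric_block: "block_sign a \<noteq> block_sign b \<Longrightarrow> pdiff c (\<lambda>q. g q $ a $ b) p = 0"
  by (simp add: metric_block)

lemma pdiff_metric_cylindrical:
  "p \<in> V \<Longrightarrow> block_sign c = 1 \<Longrightarrow> pdiff c (\<lambda>q. g q $ a $ b) p = 0"
  using cylindrical2_metric by (auto simp: cylindrical2_def cylindrical_def)

lemma cylindrical_christoffel: "cylindrical V (christoffel g a b c)"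
proof -
  have "christoffel g a b c = (\<lambda>p. (\<Sum>d\<in>UNIV. matrix_inv (g p) $ a $ d *
        (pdiff b (\<lambda>q. g q $ d $ c) p + pdiff c (\<lambda>q. g q $ d $ b) p
          - pdiff d (\<lambda>q. g q $ b $ c) p)) * (1 / 2))" (is "_ = ?r")
    by (rule ext) (simp add: christoffel_def)
  moreover have "cylindrical V ?r"
    using cylindrical2_metric
    by (intro cylindrical_mult cylindrical_sum cylindrical_const cylindrical_diff cylindrical_add
        cylindrical_inv) (auto simp: cylindrical2_def)
  ultimately show ?thesis by simp
qed

lemma pdiff_christoffel_cylindrical:
  "p \<in> V \<Longrightarrow> block_sign d = 1 \<Longrightarrow> pdiff d (christoffel g a b c) p = 0"
  using cylindrical_christoffel by (auto simp: cylindrical_def)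

text \<open>The premise says that the number of indices in \<open>{2, 3}\<close> is odd.\<close>

lemma christoffel_eq_0:
  assumes "p \<in> V" "block_sign a * block_sign b * block_sign c = 1"
  shows "christoffel g a b c p = 0"
proof -
  \<comment> \<open>Each summand vanishes by itself. If d is outside the block of a, the inverse
    entry is 0. Otherwise b, c, d contain an odd number of indices y, z, so each derivative is along
    y or z or acts on an entry between different blocks.\<close>
  have "matrix_inv (g p) $ a $ d * (pdiff b (\<lambda>q. g q $ d $ c) p + pdiff c (\<lambda>q. g q $ d $ b) p
          - pdiff d (\<lambda>q. g q $ b $ c) p) = 0" for d
    using assms block_sign_disj[of a] block_sign_disj[of b] block_sign_disj[of c]
      block_sign_disj[of d]
    by (elim disjE) (simp_all add: inv_block pdiff_metric_block pdiff_metric_cylindrical)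
  then show ?thesis unfolding christoffel_def by (simp only: sum.neutral_const div_0)
qed

lemma christoffel_symmetric: "christoffel g a b c p = christoffel g a c b p"
  by (simp add: christoffel_def metric_symmetric[of _ b c] add.commute)

text \<open>The transpose of the inverse also inverts the symmetric matrix \<open>g p\<close>, and
  inverses are unique.\<close>

lemma inv_symmetric:
  assumes "p \<in> V"
  shows "matrix_inv (g p) $ a $ b = matrix_inv (g p) $ b $ a"
proof -
  let ?I = "matrix_inv (g p)"
  have "transpose (g p) = g p"
    using metric_symmetric by (simp add: transpose_def vec_eq_iff)
  moreover have "transpose (?I ** g p) = mat 1"
    using matrix_left_right_inverse1[OF metric_inverse[OF assms]] by simp
  ultimately have eq: "?I = transpose ?I"
    by (intro matrix_inv_eqI) (simp add: matrix_transpose_mul)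
  show ?thesis by (subst eq) (simp add: transpose_def)
qed

text \<open>Differentiate the product of \<open>g\<close> and its inverse, which is constant on
  \<open>V\<close>, and solve for the derivative of the inverse.\<close>

lemma pdiff_inv:
  assumes "p \<in> V"
  shows "(\<chi> a b. pdiff c (\<lambda>q. matrix_inv (g q) $ a $ b) p) =
    - (matrix_inv (g p) ** (\<chi> a b. pdiff c (\<lambda>q. g q $ a $ b) p) ** matrix_inv (g p))"
    (is "?dI = - (?I ** ?dG ** ?I)")
proof -
  have diff: "(\<lambda>q. g q $ a $ b) differentiable (at p)"
    "(\<lambda>q. matrix_inv (g q) $ a $ b) differentiable (at p)" for a b
    using cylindrical2_metric cylindrical_inv assms by (auto simp: cylindrical2_def cylindrical_def)
  have "(g p ** ?dI + ?dG ** ?I) $ a $ b = 0" for a b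
  proof -
    have "pdiff c (\<lambda>q. \<Sum>e\<in>UNIV. g q $ a $ e * matrix_inv (g q) $ e $ b) p = pdiff c (\<lambda>_. mat 1 $ a $ b) p"
      using metric_inverse
      by (intro pdiff_transform[OF open_domain assms])
        (auto simp: matrix_matrix_mult_def mat_def vec_eq_iff)
    then show ?thesis
      by (simp add: pdiff_sum pdiff_mult diff matrix_matrix_mult_def sum.distrib)
  qed
  then have "g p ** ?dI = - (?dG ** ?I)"
    by (simp add: vec_eq_iff eq_neg_iff_add_eq_0)
  then have "?I ** (g p ** ?dI) = ?I ** (- (?dG ** ?I))" by simp
  moreover have "?I ** g p = mat 1"
    by (rule matrix_left_right_inverse1[OF metric_inverse[OF assms]])
  moreover have "?I ** (- X) = - (?I ** X)" for X :: "real ^ 4 ^ 4"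
    by (simp add: matrix_matrix_mult_def vec_eq_iff sum_negf)
  ultimately show ?thesis by (simp add: matrix_mul_assoc)
qed

text \<open>The other two derivatives of the metric cancel once the summation indices a and d are
  exchanged, the inverse being symmetric. What remains is half the trace of g^-1 dg.\<close>

lemma contracted_christoffel:
  assumes "p \<in> V"
  shows "(\<Sum>a\<in>UNIV. christoffel g a a b p) =
    1 / 2 * (\<Sum>a\<in>UNIV. \<Sum>d\<in>UNIV. matrix_inv (g p) $ a $ d * pdiff b (\<lambda>q. g q $ d $ a) p)"
proof -
  let ?I = "matrix_inv (g p)"
  have "(\<Sum>a\<in>UNIV. \<Sum>d\<in>UNIV. ?I $ a $ d * pdiff a (\<lambda>q. g q $ d $ b) p) =
      (\<Sum>a\<in>UNIV. \<Sum>d\<in>UNIV. ?I $ a $ d * pdiff d (\<lambda>q. g q $ a $ b) p)"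
    by (subst sum.swap) (simp add: inv_symmetric[OF assms])
  then show ?thesis
    by (simp add: christoffel_def sum_divide_distrib[symmetric] algebra_simps sum.distrib
        sum_subtractf)
qed

text \<open>The contracted symbols form a closed one-form. Differentiating half the trace of g^-1 dg
  gives second derivatives of \<open>g\<close>, symmetric by Young's theorem, and a product of first
  derivatives which by \<open>pdiff_inv\<close> is minus the trace of (g^-1 d_c g)(g^-1 d_b g),
  symmetric because a trace is cyclic.\<close>

lemma contracted_christoffel_curl:
  assumes "p \<in> V"
  shows "(\<Sum>a\<in>UNIV. pdiff c (christoffel g a a b) p) = (\<Sum>a\<in>UNIV. pdiff b (christoffel g a a c) p)"
proof -
  let ?I = "matrix_inv (g p)"
  let ?dG = "\<lambda>c. \<chi> a b. pdiff c (\<lambda>q. g q $ a $ b) p"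
  let ?dI = "\<lambda>c. \<chi> a b. pdiff c (\<lambda>q. matrix_inv (g q) $ a $ b) p"
  have diff: "(\<lambda>q. pdiff b (\<lambda>q. g q $ a $ d) q) differentiable (at p)"
    "(\<lambda>q. matrix_inv (g q) $ a $ d) differentiable (at p)"
    "christoffel g a d b differentiable (at p)" for a b d
    using cylindrical2_metric cylindrical_inv cylindrical_christoffel assms
    by (auto simp: cylindrical2_def cylindrical_def)
  have expand: "(\<Sum>a\<in>UNIV. pdiff c (christoffel g a a b) p) = 1 / 2 *
      ((\<Sum>a\<in>UNIV. \<Sum>d\<in>UNIV. ?I $ a $ d * pdiff c (pdiff b (\<lambda>q. g q $ d $ a)) p)
       + trace (?dI c ** ?dG b))" for b c
  proof -
    have "(\<Sum>a\<in>UNIV. pdiff c (christoffel g a a b) p) =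
        pdiff c (\<lambda>q. \<Sum>a\<in>UNIV. christoffel g a a b q) p"
      using pdiff_sum[of UNIV "\<lambda>a. christoffel g a a b" p c] diff by simp
    also have "\<dots> = pdiff c (\<lambda>q. 1 / 2 *
        (\<Sum>a\<in>UNIV. \<Sum>d\<in>UNIV. matrix_inv (g q) $ a $ d * pdiff b (\<lambda>q. g q $ d $ a) q)) p"
      by (rule pdiff_transform[OF open_domain assms contracted_christoffel])
        (assumption, intro differentiable_mult differentiable_sum differentiable_const diff ballI finite)
    also have "\<dots> = 1 / 2 * (\<Sum>a\<in>UNIV. \<Sum>d\<in>UNIV. ?I $ a $ d * pdiff c (pdiff b (\<lambda>q. g q $ d $ a)) p
        + pdiff c (\<lambda>q. matrix_inv (g q) $ a $ d) p * pdiff b (\<lambda>q. g q $ d $ a) p)"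
      using diff by (subst pdiff_cmult) (auto simp: pdiff_sum pdiff_mult intro!: differentiable_mult differentiable_sum)
    finally show ?thesis
      by (simp add: trace_def matrix_matrix_mult_def sum.distrib)
  qed
  have "trace (?dI c ** ?dG b) = - trace ((?I ** ?dG c) ** (?I ** ?dG b))" for b c
    unfolding pdiff_inv[OF assms]
    by (simp add: matrix_mul_assoc) (simp add: trace_def matrix_matrix_mult_def sum_negf)
  moreover have "trace ((?I ** ?dG c) ** (?I ** ?dG b)) = trace ((?I ** ?dG b) ** (?I ** ?dG c))"
    by (rule trace_mul_sym)
  ultimately show ?thesis
    using pdiff_commute[OF open_domain assms cylindrical2_metric, of c b] by (simp add: expand)
qed

text \<open>Of the four terms, two contain b and d only as the lower indices of one Christoffel
  symbol. The other product is symmetric after renaming a and e, and the derivative of the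
  contracted symbol is symmetric by \<open>contracted_christoffel_curl\<close>.\<close>

lemma ricci_symmetric:
  assumes "p \<in> V"
  shows "ricci g p $ b $ d = ricci g p $ d $ b"
proof -
  \<comment> \<open>Stated between functions so that it also rewrites under
    \<open>pdiff\<close>.\<close>
  have 1: "christoffel g a d b = christoffel g a b d" for a
    using christoffel_symmetric by auto
  have 2: "(\<Sum>a\<in>UNIV. \<Sum>e\<in>UNIV. christoffel g a d e p * christoffel g e a b p) =
      (\<Sum>a\<in>UNIV. \<Sum>e\<in>UNIV. christoffel g a b e p * christoffel g e a d p)"
    by (subst sum.swap, subst (1 3) christoffel_symmetric) (simp add: mult.commute)
  show ?thesis
    using contracted_christoffel_curl[OF assms, of d b] 2
    by (simp add: ricci_def riemann_def sum.distrib sum_subtractf 1)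
qed

lemma frame_component_symmetric:
  assumes "p \<in> V"
  shows "frame_component \<theta> (einstein g) \<alpha> \<beta> p = frame_component \<theta> (einstein g) \<beta> \<alpha> p"
proof -
  have "einstein g p $ a $ b = einstein g p $ b $ a" for a b
    by (simp add: einstein_def ricci_symmetric[OF assms, of a b] metric_symmetric[of p a b])
  then show ?thesis
    unfolding frame_component_def by (subst sum.swap) (simp add: ac_simps)
qed

end

section \<open>Curvature of the exchanged metric\<close>

text \<open>A single sign, that of the first index, describes the relation: entries between
  different blocks vanish, and within a block both indices have the same sign.\<close>

locale swapped_block_metric = block_metric +
  fixes g' :: tensor2
  assumes swapped_metric:
    "g' p $ a $ b = block_sign a * g (swap_tx p) $ swap_index a $ swap_index b"
begin

lemma swapped_inv:
  assumes "swap_tx p \<in> V"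
  shows "matrix_inv (g' p) $ a $ b =
    block_sign a * matrix_inv (g (swap_tx p)) $ swap_index a $ swap_index b"
proof -
  define A where "A = g (swap_tx p)"
  define B where "B = matrix_inv A"
  have AB: "(\<Sum>c\<in>UNIV. A $ i $ c * B $ c $ j) = (if i = j then 1 else 0)" for i j
    using metric_inverse[OF assms] 
    by (simp add: A_def B_def matrix_matrix_mult_def mat_def vec_eq_iff)
  have "g' p ** (\<chi> a b. block_sign a * B $ swap_index a $ swap_index b) = mat 1"
  proof -
    have "(\<Sum>c\<in>UNIV. g' p $ i $ c * (block_sign c * B $ swap_index c $ swap_index j))
      = (if i = j then 1 else 0)" for i j
    proof -
      \<comment> \<open>The two signs cancel if i and c share a block; otherwise the metric entry is
        0.\<close>
      have "g' p $ i $ c * (block_sign c * B $ swap_index c $ swap_index j) =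
          A $ swap_index i $ swap_index c * B $ swap_index c $ swap_index j" for c
        using metric_block[of "swap_index i" "swap_index c"] 
        by (cases "block_sign i = block_sign c") (simp_all add: swapped_metric A_def)
      then show ?thesis
        using AB[of "swap_index i" "swap_index j"]
          sum_swap_index[of "\<lambda>c. A $ swap_index i $ c * B $ c $ swap_index j"]
        by (simp only: swap_index_eq_iff)
    qed
    then show ?thesis
      by (simp add: matrix_matrix_mult_def mat_def vec_eq_iff)
  qed
  from matrix_inv_eqI[OF this] show ?thesis by (simp add: A_def B_def)
qed

lemma swapped_pdiff_metric:
  assumes "swap_tx p \<in> V"
  shows "pdiff c (\<lambda>q. g' q $ a $ b) p =
    block_sign a * pdiff (swap_index c) (\<lambda>q. g q $ swap_index a $ swap_index b) (swap_tx p)"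
  unfolding swapped_metric using assms cylindrical2_metric
  by (intro pdiff_swap_tx) (auto simp: cylindrical2_def cylindrical_def)

text \<open>The inverse restricts d to the block of a and contributes \<open>block_sign a\<close>.
  The first two derivatives contribute the same sign again, so their total sign is 1. The third has
  total sign \<open>block_sign a * block_sign b\<close> and vanishes unless b and c share a block.
  If they do and one of the first two survives as well, then a, b, c all lie in {t, x} and the
  product of signs is 1, so one factor fits the whole expression.\<close>

lemma swapped_christoffel:
  assumes "swap_tx p \<in> V"
  shows "christoffel g' a b c p =
    (if block_sign b = block_sign c then block_sign a * block_sign b else 1) *
      christoffel g (swap_index a) (swap_index b) (swap_index c) (swap_tx p)"
    (is "_ = ?w * _")
proof -
  let ?G = "\<lambda>d a b. pdiff d (\<lambda>q. g q $ a $ b) (swap_tx p)"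
  let ?p = swap_index
  have *: "matrix_inv (g' p) $ a $ d * (pdiff b (\<lambda>q. g' q $ d $ c) p
      + pdiff c (\<lambda>q. g' q $ d $ b) p - pdiff d (\<lambda>q. g' q $ b $ c) p) =
    ?w * (matrix_inv (g (swap_tx p)) $ ?p a $ ?p d *
      (?G (?p b) (?p d) (?p c) + ?G (?p c) (?p d) (?p b) - ?G (?p d) (?p b) (?p c)))" for d
    using assms block_sign_disj[of a] block_sign_disj[of b] block_sign_disj[of c]
      block_sign_disj[of d]
    by (elim disjE)
      (simp_all add: swapped_inv swapped_pdiff_metric inv_block pdiff_metric_block
        pdiff_metric_cylindrical algebra_simps)
  show ?thesis
    unfolding christoffel_def * sum_distrib_left[symmetric]
    using sum_swap_index[of "\<lambda>d. matrix_inv (g (swap_tx p)) $ ?p a $ d *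
      (?G (?p b) d (?p c) + ?G (?p c) d (?p b) - ?G d (?p b) (?p c))"]
    by simp
qed

lemma swapped_pdiff_christoffel:
  assumes "swap_tx p \<in> V"
  shows "pdiff d (christoffel g' a b c) p =
    (if block_sign b = block_sign c then block_sign a * block_sign b else 1) *
      pdiff (swap_index d) (christoffel g (swap_index a) (swap_index b) (swap_index c)) (swap_tx p)"
    (is "_ = ?w * pdiff _ ?C _")
proof -
  have diff: "?C differentiable (at (swap_tx p))"
    using cylindrical_christoffel assms by (auto simp: cylindrical_def)
  have "(\<lambda>q. ?w * ?C (swap_tx q)) differentiable (at p)"
    using diff bounded_linear_imp_differentiable[OF bounded_linear_swap_tx]
    by (intro differentiable_mult differentiable_const)
      (simp add: differentiable_chain_at[of swap_tx p ?C, unfolded o_def])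
  then have "pdiff d (christoffel g' a b c) p = pdiff d (\<lambda>q. ?w * ?C (swap_tx q)) p"
    using open_swap_tx_vimage[OF open_domain] assms swapped_christoffel
    by (intro pdiff_transform[of "swap_tx -` V"]) auto
  then show ?thesis using pdiff_swap_tx[OF diff] by simp
qed

text \<open>Covers the components that enter the Ricci tensor within one block. The weights of the
  single symbols vary, but every surviving term has sign \<open>- block_sign b\<close>: a product
  survives only if both factors have an even number of indices y, z, and a derivative only along t
  or x.\<close>

lemma swapped_riemann:
  assumes "swap_tx p \<in> V" "block_sign b = block_sign d"
  shows "riemann g' a b a d p = - block_sign b *
    riemann g (swap_index a) (swap_index b) (swap_index a) (swap_index d) (swap_tx p)"
proof -
  let ?C = "\<lambda>a b c. christoffel g (swap_index a) (swap_index b) (swap_index c) (swap_tx p)"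
  have prod: "christoffel g' a a e p * christoffel g' e d b p
        - christoffel g' a d e p * christoffel g' e a b p =
      - block_sign b * (?C a a e * ?C e d b - ?C a d e * ?C e a b)" for e
    using assms(1) assms(2)[symmetric] block_sign_disj[of a] block_sign_disj[of b]
      block_sign_disj[of e]
    by (elim disjE) (simp_all add: swapped_christoffel christoffel_eq_0)
  have deriv: "pdiff a (christoffel g' a d b) p - pdiff d (christoffel g' a a b) p =
      - block_sign b *
      (pdiff (swap_index a) (christoffel g (swap_index a) (swap_index d) (swap_index b)) (swap_tx p)
      - pdiff (swap_index d) (christoffel g (swap_index a) (swap_index a) (swap_index b)) (swap_tx p))"
    using assms(1) assms(2)[symmetric] block_sign_disj[of a] block_sign_disj[of b]
    by (elim disjE) (simp_all add: swapped_pdiff_christoffel pdiff_christoffel_cylindrical)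
  show ?thesis
    unfolding riemann_def prod deriv sum_distrib_left[symmetric]
    using sum_swap_index[of "\<lambda>e. christoffel g (swap_index a) (swap_index a) e (swap_tx p)
        * christoffel g e (swap_index d) (swap_index b) (swap_tx p)
      - christoffel g (swap_index a) (swap_index d) e (swap_tx p)
        * christoffel g e (swap_index a) (swap_index b) (swap_tx p)"]
    by (simp only: distrib_left)
qed

lemma swapped_ricci:
  assumes "swap_tx p \<in> V" "block_sign b = block_sign d"
  shows "ricci g' p $ b $ d =
    - block_sign b * ricci g (swap_tx p) $ swap_index b $ swap_index d"
  unfolding ricci_def
  using sum_swap_index[of "\<lambda>a. riemann g a (swap_index b) a (swap_index d) (swap_tx p)"]
  by (simp add: swapped_riemann[OF assms] sum_distrib_left[symmetric] sum_negf)

text \<open>The inverse metric gives \<open>block_sign a\<close> and the Ricci tensor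
  \<open>- block_sign a\<close>, together -1. Ricci components between different blocks, on which
  \<open>swapped_ricci\<close> is silent, meet a zero of the inverse metric.\<close>

lemma swapped_scalar_curvature:
  assumes "swap_tx p \<in> V"
  shows "scalar_curvature g' p = - scalar_curvature g (swap_tx p)"
proof -
  have "matrix_inv (g' p) $ a $ b * ricci g' p $ a $ b =
      - (matrix_inv (g (swap_tx p)) $ swap_index a $ swap_index b *
        ricci g (swap_tx p) $ swap_index a $ swap_index b)" for a b
    using block_sign_mult_self[of a]
    by (cases "block_sign a = block_sign b")
      (simp_all add: swapped_inv[OF assms] swapped_ricci[OF assms] inv_block[OF assms])
  then have "scalar_curvature g' p = - (\<Sum>a\<in>UNIV. \<Sum>b\<in>UNIV.
      matrix_inv (g (swap_tx p)) $ swap_index a $ swap_index b *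
        ricci g (swap_tx p) $ swap_index a $ swap_index b)"
    by (simp add: scalar_curvature_def sum_negf)
  also have "\<dots> = - (\<Sum>a\<in>UNIV. \<Sum>b\<in>UNIV.
      matrix_inv (g (swap_tx p)) $ swap_index a $ b * ricci g (swap_tx p) $ swap_index a $ b)"
    using sum_swap_index[of "\<lambda>b. matrix_inv (g (swap_tx p)) $ swap_index a $ b *
      ricci g (swap_tx p) $ swap_index a $ b" for a] by simp
  also have "\<dots> = - scalar_curvature g (swap_tx p)"
    unfolding scalar_curvature_def
    using sum_swap_index[of "\<lambda>a. \<Sum>b\<in>UNIV. matrix_inv (g (swap_tx p)) $ a $ b *
      ricci g (swap_tx p) $ a $ b"] by simp
  finally show ?thesis .
qed

lemma swapped_einstein:
  assumes "swap_tx p \<in> V" "block_sign a = block_sign b"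
  shows "einstein g' p $ a $ b =
    - block_sign a * einstein g (swap_tx p) $ swap_index a $ swap_index b"
  using assms
  by (simp add: einstein_def swapped_ricci swapped_scalar_curvature swapped_metric algebra_simps)

text \<open>The coframe is permuted in rows and columns without any sign, hence so is the dual
  frame. Its block form confines a and b to the blocks of \<alpha> and \<beta>, so only the
  components covered by \<open>swapped_einstein\<close> contribute.\<close>

lemma swapped_frame_component:
  assumes "swap_tx p \<in> V" "block_sign \<alpha> = block_sign \<beta>"
    and coframe_inverse: "\<theta> (swap_tx p) ** matrix_inv (\<theta> (swap_tx p)) = mat 1"
    and coframe_block: "\<And>a b. block_sign a \<noteq> block_sign b \<Longrightarrow>
      matrix_inv (\<theta> (swap_tx p)) $ a $ b = 0"
    and swapped_coframe: "\<And>a b. \<theta>' p $ a $ b = \<theta> (swap_tx p) $ swap_index a $ swap_index b"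
  shows "frame_component \<theta>' (einstein g') \<alpha> \<beta> p = - block_sign \<alpha> *
    frame_component \<theta> (einstein g) (swap_index \<alpha>) (swap_index \<beta>) (swap_tx p)"
proof -
  let ?p = swap_index and ?E = "matrix_inv (\<theta> (swap_tx p))" and ?T = "einstein g (swap_tx p)"
  have "(\<Sum>c\<in>UNIV. \<theta>' p $ i $ c * ?E $ ?p c $ ?p j) = (if i = j then 1 else 0)" for i j
  proof -
    have "(\<Sum>c\<in>UNIV. \<theta> (swap_tx p) $ ?p i $ c * ?E $ c $ ?p j) = (if i = j then 1 else 0)"
      using coframe_inverse by (simp add: matrix_matrix_mult_def mat_def vec_eq_iff)
    then show ?thesis
      using sum_swap_index[of "\<lambda>c. \<theta> (swap_tx p) $ ?p i $ c * ?E $ c $ ?p j"]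
      by (simp add: swapped_coframe)
  qed
  then have "\<theta>' p ** (\<chi> a b. ?E $ ?p a $ ?p b) = mat 1"
    by (simp add: matrix_matrix_mult_def mat_def vec_eq_iff)
  then have inv: "matrix_inv (\<theta>' p) $ a $ b = ?E $ ?p a $ ?p b" for a b
    by (simp add: matrix_inv_eqI)
  have "einstein g' p $ a $ b * matrix_inv (\<theta>' p) $ a $ \<alpha> * matrix_inv (\<theta>' p) $ b $ \<beta> =
      - block_sign \<alpha> * (?T $ ?p a $ ?p b * ?E $ ?p a $ ?p \<alpha> * ?E $ ?p b $ ?p \<beta>)" for a b
    using assms(2) swapped_einstein[OF assms(1), of a b]
      coframe_block[of "?p a" "?p \<alpha>"] coframe_block[of "?p b" "?p \<beta>"]
    by (cases "block_sign a = block_sign \<alpha>"; cases "block_sign b = block_sign \<beta>")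
      (simp_all add: inv)
  then have "frame_component \<theta>' (einstein g') \<alpha> \<beta> p = - block_sign \<alpha> *
      (\<Sum>a\<in>UNIV. \<Sum>b\<in>UNIV. ?T $ ?p a $ ?p b * ?E $ ?p a $ ?p \<alpha> * ?E $ ?p b $ ?p \<beta>)"
    by (simp only: frame_component_def sum_distrib_left)
  also have "(\<Sum>a\<in>UNIV. \<Sum>b\<in>UNIV. ?T $ ?p a $ ?p b * ?E $ ?p a $ ?p \<alpha> * ?E $ ?p b $ ?p \<beta>) =
      (\<Sum>a\<in>UNIV. \<Sum>b\<in>UNIV. ?T $ ?p a $ b * ?E $ ?p a $ ?p \<alpha> * ?E $ b $ ?p \<beta>)"
    using sum_swap_index[of "\<lambda>b. ?T $ ?p a $ b * ?E $ ?p a $ ?p \<alpha> * ?E $ b $ ?p \<beta>" for a]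
    by simp
  also have "\<dots> = frame_component \<theta> (einstein g) (?p \<alpha>) (?p \<beta>) (swap_tx p)"
    unfolding frame_component_def
    using sum_swap_index[of "\<lambda>a. \<Sum>b\<in>UNIV. ?T $ a $ b * ?E $ a $ ?p \<alpha> * ?E $ b $ ?p \<beta>"]
    by simp
  finally show ?thesis .
qed

end

section \<open>Explicit inverses of the line element and the coframe\<close>

text \<open>The contravariant metric in the basis d_t, d_x, d_y - W d_z, d_z dual to dt, dx, dy, dz
  + W dy; here \<open>covec_square\<close> squares vectors.\<close>

definition line_element_inv ::
  "(real \<times> real \<Rightarrow> real) \<Rightarrow> (real \<times> real \<Rightarrow> real) \<Rightarrow> (real \<times> real \<Rightarrow> real) \<Rightarrow> (real \<times> real \<Rightarrow> real)
    \<Rightarrow> tensor2" where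
  "line_element_inv S F P W p =
     (let u = (p $ 0, p $ 1) in
      (S u)\<^sup>2 *\<^sub>R
        (- covec_square (axis 0 1) + covec_square (axis 1 1)
         + inverse (F u) *\<^sub>R (P u *\<^sub>R covec_square (axis 2 1 - W u *\<^sub>R axis 3 1)
                   + inverse (P u) *\<^sub>R covec_square (axis 3 1))))"

lemma line_element_mult_inv:
  assumes "S (p $ 0, p $ 1) \<noteq> 0" "F (p $ 0, p $ 1) > 0" "P (p $ 0, p $ 1) > 0"
  shows "line_element S F P W p ** line_element_inv S F P W p = mat 1"
proof -
  have "(line_element S F P W p ** line_element_inv S F P W p) $ i $ j = mat 1 $ i $ j" for i j
    using assms index4_cases[of i] index4_cases[of j]
    by (elim disjE)
      (simp_all add: matrix_matrix_mult_def sum_index4 line_element_def line_element_inv_def Let_def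
        covec_square_def dcoord_def axis_def mat_def field_simps power2_eq_square)
  then show ?thesis by (simp add: vec_eq_iff)
qed

text \<open>The rows before transposition are the vectors of the orthonormal frame dual to
  \<open>coframe\<close>.\<close>

definition coframe_inv ::
  "(real \<times> real \<Rightarrow> real) \<Rightarrow> (real \<times> real \<Rightarrow> real) \<Rightarrow> (real \<times> real \<Rightarrow> real) \<Rightarrow> (real \<times> real \<Rightarrow> real)
    \<Rightarrow> tensor2" where
  "coframe_inv S F P W p =
     (let u = (p $ 0, p $ 1) in
      transpose (\<chi> \<alpha>. if \<alpha> = 0 then S u *\<^sub>R axis 0 1
           else if \<alpha> = 1 then S u *\<^sub>R axis 1 1
           else if \<alpha> = 2 then (S u / sqrt (F u / P u)) *\<^sub>R (axis 2 1 - W u *\<^sub>R axis 3 1)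
           else (S u / sqrt (F u * P u)) *\<^sub>R axis 3 1))"

lemma coframe_mult_inv:
  assumes "S (p $ 0, p $ 1) \<noteq> 0" "F (p $ 0, p $ 1) > 0" "P (p $ 0, p $ 1) > 0"
  shows "coframe S F P W p ** coframe_inv S F P W p = mat 1"
proof -
  have "F (p $ 0, p $ 1) \<noteq> 0" "P (p $ 0, p $ 1) \<noteq> 0"
    using assms by auto
  then have "(coframe S F P W p ** coframe_inv S F P W p) $ i $ j = mat 1 $ i $ j" for i j
    using assms(1) index4_cases[of i] index4_cases[of j]
    by (elim disjE)
      (simp_all add: matrix_matrix_mult_def sum_index4 coframe_def coframe_inv_def Let_def
        transpose_def dcoord_def axis_def mat_def)
  then show ?thesis by (simp add: vec_eq_iff)
qed

lemma coframe_inv_block: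
  "block_sign a \<noteq> block_sign b \<Longrightarrow> coframe_inv S F P W p $ a $ b = 0"
  using index4_cases[of a] index4_cases[of b]
  by (elim disjE)
    (simp_all add: coframe_inv_def Let_def transpose_def axis_def block_sign_def)

lemma block_metric_line_element:
  assumes "open U" "smooth_on U S" "smooth_on U F" "smooth_on U P" "smooth_on U W"
    and nz: "\<And>u. u \<in> U \<Longrightarrow> S u \<noteq> 0" "\<And>u. u \<in> U \<Longrightarrow> F u > 0" "\<And>u. u \<in> U \<Longrightarrow> P u > 0"
  shows "block_metric (line_element S F P W) {p. (p $ 0, p $ 1) \<in> U}"
proof
  let ?V = "{p::real^4. (p $ 0, p $ 1) \<in> U}"
  show V: "open ?V" using assms(1) by (rule open_lift)
  note lift = assms(2-5)[THEN cylindrical2_lift[OF assms(1)]]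
  have inv: "matrix_inv (line_element S F P W p) = line_element_inv S F P W p" if "p \<in> ?V" for p
    using that nz by (intro matrix_inv_eqI line_element_mult_inv) auto
  show "cylindrical2 ?V (\<lambda>p. line_element S F P W p $ a $ b)" for a b
  proof -
    \<comment> \<open>Every entry has this shape, with constants read off from the coordinate
      one-forms, so the closure rules are applied once for all entries.\<close>
    have "cylindrical2 ?V (\<lambda>p. inverse (S (p $ 0, p $ 1) * S (p $ 0, p $ 1)) *
      (c1 + F (p $ 0, p $ 1) * (inverse (P (p $ 0, p $ 1)) * c2 +
        P (p $ 0, p $ 1) * ((c3 + W (p $ 0, p $ 1) * c4) * (c5 + W (p $ 0, p $ 1) * c6)))))"
      for c1 c2 c3 c4 c5 c6
      using nz(1,3)
      by (intro cylindrical2_mult[OF V] cylindrical2_add[OF V] cylindrical2_inverse[OF V]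
          cylindrical2_const lift) (auto simp: less_imp_neq[symmetric] dest: nz(3))
    from this[of "- (dt $ a * dt $ b) + dx $ a * dx $ b" "dy $ a * dy $ b"
        "dz $ a" "dy $ a" "dz $ b" "dy $ b"]
    show ?thesis
      by (simp add: line_element_def Let_def covec_square_def power2_eq_square divide_inverse)
  qed
  show "cylindrical ?V (\<lambda>p. matrix_inv (line_element S F P W p) $ a $ b)" for a b
  proof -
    have lift': "cylindrical ?V (\<lambda>p. h (p $ 0, p $ 1))" if "h \<in> {S, F, P, W}" for h
      using that lift by (auto simp: cylindrical2_def)
    \<comment> \<open>The same device for the entries of \<open>line_element_inv\<close>, with
      constants from the dual vectors.\<close>
    have "cylindrical ?V (\<lambda>p. (S (p $ 0, p $ 1) * S (p $ 0, p $ 1)) *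
      (c1 + inverse (F (p $ 0, p $ 1)) * (inverse (P (p $ 0, p $ 1)) * c2 +
        P (p $ 0, p $ 1) * ((c3 - W (p $ 0, p $ 1) * c4) * (c5 - W (p $ 0, p $ 1) * c6)))))"
      for c1 c2 c3 c4 c5 c6
      using lift'
      by (intro cylindrical_mult cylindrical_add cylindrical_diff cylindrical_inverse
          cylindrical_const lift') (auto dest: nz(2,3))
    from this[of "- (axis 0 1 $ a * axis 0 1 $ b) + axis 1 1 $ a * axis 1 1 $ b"
        "axis 3 1 $ a * axis 3 1 $ b" "axis 2 1 $ a" "axis 3 1 $ a" "axis 2 1 $ b" "axis 3 1 $ b"]
    have "cylindrical ?V (\<lambda>p. line_element_inv S F P W p $ a $ b)"
      by (simp add: line_element_inv_def Let_def covec_square_def power2_eq_square add.commute)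
    then show ?thesis
      by (rule cylindrical_cong[OF V]) (simp add: inv)
  qed
  show "line_element S F P W p $ a $ b = line_element S F P W p $ b $ a" for a b p
    by (simp add: line_element_def Let_def covec_square_def mult.commute)
  show "line_element S F P W p $ a $ b = 0" if "block_sign a \<noteq> block_sign b" for a b p
    using that index4_cases[of a] index4_cases[of b]
    by (elim disjE) (simp_all add: line_element_def Let_def covec_square_def dcoord_def axis_def
        block_sign_def)
  show "matrix_inv (line_element S F P W p) $ a $ b = 0"
    if "p \<in> ?V" "block_sign a \<noteq> block_sign b" for a b p
    using that(2) index4_cases[of a] index4_cases[of b] unfolding inv[OF that(1)]
    by (elim disjE) (simp_all add: line_element_inv_def Let_def covec_square_def axis_def
        block_sign_def)
  show "line_element S F P W p ** matrix_inv (line_element S F P W p) = mat 1" if "p \<in> ?V" for p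
    using that nz by (simp add: inv line_element_mult_inv)
qed

section \<open>The field equations under the exchange\<close>

theorem lemma1:
  fixes U :: "(real \<times> real) set" and S F P W :: "real \<times> real \<Rightarrow> real"
  assumes "open U"
    and "smooth_on U S" "smooth_on U F" "smooth_on U P" "smooth_on U W"
    and "\<And>u. u \<in> U \<Longrightarrow> S u \<noteq> 0" "\<And>u. u \<in> U \<Longrightarrow> F u > 0" "\<And>u. u \<in> U \<Longrightarrow> P u > 0"
    and "\<And>p :: real ^ 4. (p $ 0, p $ 1) \<in> U \<Longrightarrow> field_equations_at S F P W p"
  shows "\<forall>p :: real ^ 4. (p $ 1, p $ 0) \<in> U \<longrightarrow>
    field_equations_at (\<lambda>(t, x). S (x, t)) (\<lambda>(t, x). F (x, t))
      (\<lambda>(t, x). P (x, t)) (\<lambda>(t, x). W (x, t)) p"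
proof (intro allI impI)
  fix p :: "real ^ 4"
  assume p: "(p $ 1, p $ 0) \<in> U"
  let ?V = "{p::real^4. (p $ 0, p $ 1) \<in> U}"
  let ?S' = "\<lambda>(t, x). S (x, t)" and ?F' = "\<lambda>(t, x). F (x, t)"
    and ?P' = "\<lambda>(t, x). P (x, t)" and ?W' = "\<lambda>(t, x). W (x, t)"
  have swap [simp]: "swap_index 0 = 1" "swap_index 1 = 0" "swap_index 2 = 2" "swap_index 3 = 3"
    by (simp_all add: swap_index_def)
  have sign [simp]: "block_sign 0 = -1" "block_sign 1 = -1" "block_sign 2 = 1" "block_sign 3 = 1"
    by (simp_all add: block_sign_def)
  interpret block_metric "line_element S F P W" ?V
    using assms(1-8) by (rule block_metric_line_element)
  interpret swapped_block_metric "line_element S F P W" ?V "line_element ?S' ?F' ?P' ?W'"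
  proof
    \<comment> \<open>Permuting the indices turns the pattern (-1, 1) of the (t, x)-block into (1,
      -1), which \<open>block_sign\<close> reverses.\<close>
    show "line_element ?S' ?F' ?P' ?W' q $ a $ b =
      block_sign a * line_element S F P W (swap_tx q) $ swap_index a $ swap_index b" for q a b
      using index4_cases[of a] index4_cases[of b]
      by (elim disjE) (simp_all add: line_element_def Let_def covec_square_def dcoord_def axis_def)
  qed
  have pV: "swap_tx p \<in> ?V" using p by simp
  have nz: "S (swap_tx p $ 0, swap_tx p $ 1) \<noteq> 0" "F (swap_tx p $ 0, swap_tx p $ 1) > 0"
    "P (swap_tx p $ 0, swap_tx p $ 1) > 0"
    using p assms(6-8) by auto
  have frame: "einstein_frame ?S' ?F' ?P' ?W' \<alpha> \<beta> p = - block_sign \<alpha> *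
      einstein_frame S F P W (swap_index \<alpha>) (swap_index \<beta>) (swap_tx p)"
    if "block_sign \<alpha> = block_sign \<beta>" for \<alpha> \<beta>
    unfolding einstein_frame_def
  proof (rule swapped_frame_component[OF pV that])
    note inv = coframe_mult_inv[of S "swap_tx p" F P W, OF nz]
    show "coframe S F P W (swap_tx p) ** matrix_inv (coframe S F P W (swap_tx p)) = mat 1"
      using inv matrix_inv_eqI[OF inv] by simp
    show "matrix_inv (coframe S F P W (swap_tx p)) $ a $ b = 0" if "block_sign a \<noteq> block_sign b"
      for a b
      using that matrix_inv_eqI[OF inv] by (simp add: coframe_inv_block)
    show "coframe ?S' ?F' ?P' ?W' p $ a $ b =
      coframe S F P W (swap_tx p) $ swap_index a $ swap_index b" for a b
      using index4_cases[of a] index4_cases[of b]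
      by (elim disjE) (simp_all add: coframe_def Let_def dcoord_def axis_def)
  qed
  have sym: "einstein_frame S F P W 1 0 (swap_tx p) = einstein_frame S F P W 0 1 (swap_tx p)"
    unfolding einstein_frame_def by (rule frame_component_symmetric[OF pV])
  have "field_equations_at S F P W (swap_tx p)"
    using p by (intro assms(9)) simp
  then show "field_equations_at ?S' ?F' ?P' ?W' p"
    \<comment> \<open>The factors S_00 + S_22 and S_11 - S_22 become S_11 - S_22 and S_00 + S_22, so
      their product is unchanged; \<open>sym\<close> restores S_01, and the two linear equations
      only change sign.\<close>
    by (auto simp: field_equations_at_def Let_def frame sym algebra_simps)
qed

end
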